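(* Let $A$ be a monoid. A skew monoidal monoid structure $\langle *,\gamma,\eta,\varepsilon\rangle$ on $A$ is the same as the following data: two monoid endomorphisms $T,Q:A\to A$ and elements $\gamma,\eta,\varepsilon\in A$ such that for all $a,b\in A$ $$T(a)Q(b)=Q(b)T(a),$$ $$\gamma T^2(a)=T(a)\gamma,\qquad \gamma TQ(a)=QT(a)\gamma,\qquad \gamma Q(a)=Q^2(a)\gamma,$$ $$\eta a=T(a)\eta,\qquad a\varepsilon=\varepsilon Q(a),$$ and $$Q(\gamma)\gamma T(\gamma)=\gamma^2,\quad \gamma\eta=Q(\eta),\quad \varepsilon\gamma=T(\varepsilon),\quad Q(\varepsilon)\gamma T(\eta)=1,\quad \varepsilon\eta=1.$$ Explicitly, the assignment $\langle *,\gamma,\eta,\varepsilon\rangle\mapsto\langle T,Q,\gamma,\eta,\varepsilon\rangle$ with $T(a)=1*a$ and $Q(a)=a*1$ is a bijection from the set of skew monoidal monoid structures on $A$ to the set of such data, with inverse given by $a*b=Q(a)T(b)$.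
   Context: A skew monoidal monoid $\langle A,*,\gamma,\eta,\varepsilon\rangle$ is a (right) skew monoidal category whose underlying category has one object. Explicitly, it consists of a monoid $A$ with unit $1$, a monoid morphism $A\times A\to A$, $\langle a,b\rangle\mapsto a*b$ (so $(ab)*(cd)=(a*c)(b*d)$ and $1*1=1$), and elements $\gamma,\eta,\varepsilon\in A$ such that for all $a,b,c\in A$ $$\gamma(a*(b*c))=((a*b)*c)\gamma,\qquad \eta a=(1*a)\eta,\qquad a\varepsilon=\varepsilon(a*1),$$ and $$(\gamma*1)\gamma(1*\gamma)=\gamma^2,\quad \gamma\eta=\eta*1,\quad \varepsilon\gamma=1*\varepsilon,\quad (\varepsilon*1)\gamma(1*\eta)=1,\quad \varepsilon\eta=1.$$ *)

theory Defs
  imports Main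
begin

text \<open>
  Composition in the monoid \<open>A\<close> is the multiplication of the type \<open>'a\<close>; the second
  operation \<open>\<star>\<close> is the tensor product. The assumptions \<open>interchange\<close> and
  \<open>star_one\<close> say that \<open>\<star>\<close> is a monoid morphism from \<open>A \<times> A\<close> to \<open>A\<close>.
\<close>

locale skew_monoidal_monoid =
  fixes star :: "'a::monoid_mult \<Rightarrow> 'a \<Rightarrow> 'a"  (infixl \<open>\<star>\<close> 75)
    and \<gamma> \<eta> \<epsilon> :: 'a
  assumes interchange: "(a * b) \<star> (c * d) = (a \<star> c) * (b \<star> d)"
    and star_one: "1 \<star> 1 = 1"
    and \<gamma>_natural: "\<gamma> * (a \<star> (b \<star> c)) = ((a \<star> b) \<star> c) * \<gamma>"
    and \<eta>_natural: "\<eta> * a = (1 \<star> a) * \<eta>"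
    and \<epsilon>_natural: "a * \<epsilon> = \<epsilon> * (a \<star> 1)"
    and pentagon: "(\<gamma> \<star> 1) * \<gamma> * (1 \<star> \<gamma>) = \<gamma>\<^sup>2"
    and \<gamma>_\<eta>: "\<gamma> * \<eta> = \<eta> \<star> 1"
    and \<epsilon>_\<gamma>: "\<epsilon> * \<gamma> = 1 \<star> \<epsilon>"
    and triangle: "(\<epsilon> \<star> 1) * \<gamma> * (1 \<star> \<eta>) = 1"
    and \<epsilon>_\<eta>: "\<epsilon> * \<eta> = 1"

definition monoid_endomorphism :: "('a::monoid_mult \<Rightarrow> 'a) \<Rightarrow> bool" where
  "monoid_endomorphism f \<longleftrightarrow> f 1 = 1 \<and> (\<forall>a b. f (a * b) = f a * f b)"

locale skew_endomorphism_data =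
  fixes T Q :: "'a::monoid_mult \<Rightarrow> 'a"
    and \<gamma> \<eta> \<epsilon> :: 'a
  assumes T_endo: "monoid_endomorphism T"
    and Q_endo: "monoid_endomorphism Q"
    and T_Q_commute: "T a * Q b = Q b * T a"
    and \<gamma>_TT: "\<gamma> * T (T a) = T a * \<gamma>"
    and \<gamma>_TQ: "\<gamma> * T (Q a) = Q (T a) * \<gamma>"
    and \<gamma>_Q: "\<gamma> * Q a = Q (Q a) * \<gamma>"
    and \<eta>_T: "\<eta> * a = T a * \<eta>"
    and \<epsilon>_Q: "a * \<epsilon> = \<epsilon> * Q a"
    and pentagon: "Q \<gamma> * \<gamma> * T \<gamma> = \<gamma>\<^sup>2"
    and \<gamma>_\<eta>: "\<gamma> * \<eta> = Q \<eta>"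
    and \<epsilon>_\<gamma>: "\<epsilon> * \<gamma> = T \<epsilon>"
    and triangle: "Q \<epsilon> * \<gamma> * T \<eta> = 1"
    and \<epsilon>_\<eta>: "\<epsilon> * \<eta> = 1"

definition skew_monoidal_structures ::
    "(('a::monoid_mult \<Rightarrow> 'a \<Rightarrow> 'a) \<times> 'a \<times> 'a \<times> 'a) set" where
  "skew_monoidal_structures = {(star, \<gamma>, \<eta>, \<epsilon>). skew_monoidal_monoid star \<gamma> \<eta> \<epsilon>}"

definition skew_endomorphism_data_set ::
    "(('a::monoid_mult \<Rightarrow> 'a) \<times> ('a \<Rightarrow> 'a) \<times> 'a \<times> 'a \<times> 'a) set" where
  "skew_endomorphism_data_set = {(T, Q, \<gamma>, \<eta>, \<epsilon>). skew_endomorphism_data T Q \<gamma> \<eta> \<epsilon>}"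

definition to_endomorphisms ::
    "('a::monoid_mult \<Rightarrow> 'a \<Rightarrow> 'a) \<times> 'a \<times> 'a \<times> 'a
      \<Rightarrow> ('a \<Rightarrow> 'a) \<times> ('a \<Rightarrow> 'a) \<times> 'a \<times> 'a \<times> 'a" where
  "to_endomorphisms = (\<lambda>(star, \<gamma>, \<eta>, \<epsilon>). (\<lambda>a. star 1 a, \<lambda>a. star a 1, \<gamma>, \<eta>, \<epsilon>))"

definition of_endomorphisms ::
    "('a::monoid_mult \<Rightarrow> 'a) \<times> ('a \<Rightarrow> 'a) \<times> 'a \<times> 'a \<times> 'a
      \<Rightarrow> ('a \<Rightarrow> 'a \<Rightarrow> 'a) \<times> 'a \<times> 'a \<times> 'a" where
  "of_endomorphisms = (\<lambda>(T, Q, \<gamma>, \<eta>, \<epsilon>). (\<lambda>a b. Q a * T b, \<gamma>, \<eta>, \<epsilon>))"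

end

theory Submission
  imports Defs
begin

text \<open>In the monoid A \<times> A the pair (a, b) factors as (a, 1)(1, b) and as (1, b)(a, 1).
  So a monoid morphism out of A \<times> A amounts to two endomorphisms Q and T with commuting
  images, recovered by restricting to the two factors and recombined as \<open>Q a * T b\<close>.
  Under this dictionary the laws for \<open>\<eta>\<close> and \<open>\<epsilon>\<close> and the
  five coherence equations are literally the same on both sides. Naturality of
  \<open>\<gamma>\<close> in three variables splits into three one-variable laws, since each triple
  is a product of triples with a single entry other than 1.\<close>

context skew_monoidal_monoid
begin

lemma star_eq_left_right: "(a \<star> 1) * (1 \<star> b) = a \<star> b"
  using interchange[of a 1 1 b] by simp

lemma star_eq_right_left: "(1 \<star> b) * (a \<star> 1) = a \<star> b"
  using interchange[of 1 a b 1] by simp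

lemma skew_endomorphism_data: "skew_endomorphism_data (\<lambda>a. 1 \<star> a) (\<lambda>a. a \<star> 1) \<gamma> \<eta> \<epsilon>"
proof
  show "monoid_endomorphism (\<lambda>a. 1 \<star> a)"
    using interchange[of 1 1] by (simp add: monoid_endomorphism_def star_one)
  show "monoid_endomorphism (\<lambda>a. a \<star> 1)"
    using interchange[of _ _ 1 1] by (simp add: monoid_endomorphism_def star_one)
next
  fix a b
  show "(1 \<star> a) * (b \<star> 1) = (b \<star> 1) * (1 \<star> a)"
    by (simp only: star_eq_left_right star_eq_right_left)
  \<comment> \<open>The three laws for \<open>\<gamma>\<close> are its naturality with the variable
    in the third, second and first slot and 1 elsewhere.\<close>
  show "\<gamma> * (1 \<star> (1 \<star> a)) = (1 \<star> a) * \<gamma>"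
    using \<gamma>_natural[of 1 1 a] by (simp add: star_one)
  show "\<gamma> * (1 \<star> (a \<star> 1)) = ((1 \<star> a) \<star> 1) * \<gamma>"
    by (rule \<gamma>_natural)
  show "\<gamma> * (a \<star> 1) = ((a \<star> 1) \<star> 1) * \<gamma>"
    using \<gamma>_natural[of a 1 1] by (simp add: star_one)
qed (fact \<eta>_natural \<epsilon>_natural pentagon \<gamma>_\<eta> \<epsilon>_\<gamma> triangle \<epsilon>_\<eta>)+

end

context skew_endomorphism_data
begin

lemma T_one [simp]: "T 1 = 1"
  and T_mult: "T (a * b) = T a * T b"
  and Q_one [simp]: "Q 1 = 1"
  and Q_mult: "Q (a * b) = Q a * Q b"
  using T_endo Q_endo by (auto simp: monoid_endomorphism_def)

lemma skew_monoidal_monoid: "skew_monoidal_monoid (\<lambda>a b. Q a * T b) \<gamma> \<eta> \<epsilon>"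
proof
  fix a b c d
  \<comment> \<open>Interchange amounts to swapping the two middle factors, which is what commuting
    images provide.\<close>
  have "Q a * (Q b * T c) * T d = Q a * (T c * Q b) * T d"
    by (simp only: T_Q_commute)
  then show "Q (a * b) * T (c * d) = Q a * T c * (Q b * T d)"
    by (simp add: Q_mult T_mult mult.assoc)
  \<comment> \<open>\<open>\<gamma>\<close> is moved rightwards past one factor at a time, each by
    its own one-variable law.\<close>
  have "\<gamma> * (Q a * T (Q b * T c)) = (\<gamma> * Q a) * T (Q b) * T (T c)"
    by (simp add: T_mult mult.assoc)
  also have "\<dots> = Q (Q a) * (\<gamma> * T (Q b)) * T (T c)"
    by (simp add: \<gamma>_Q mult.assoc)
  also have "\<dots> = Q (Q a) * Q (T b) * (\<gamma> * T (T c))"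
    by (simp add: \<gamma>_TQ mult.assoc)
  also have "\<dots> = Q (Q a * T b) * T c * \<gamma>"
    by (simp add: \<gamma>_TT Q_mult mult.assoc)
  finally show "\<gamma> * (Q a * T (Q b * T c)) = Q (Q a * T b) * T c * \<gamma>" .
qed (simp_all add: \<eta>_T \<epsilon>_Q pentagon \<gamma>_\<eta> \<epsilon>_\<gamma> triangle \<epsilon>_\<eta>)

end

lemma to_endomorphisms_in:
  "s \<in> skew_monoidal_structures \<Longrightarrow> to_endomorphisms s \<in> skew_endomorphism_data_set"
  by (auto simp: skew_monoidal_structures_def skew_endomorphism_data_set_def to_endomorphisms_def
      intro: skew_monoidal_monoid.skew_endomorphism_data)

lemma of_endomorphisms_in:
  "d \<in> skew_endomorphism_data_set \<Longrightarrow> of_endomorphisms d \<in> skew_monoidal_structures"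
  by (auto simp: skew_monoidal_structures_def skew_endomorphism_data_set_def of_endomorphisms_def
      intro: skew_endomorphism_data.skew_monoidal_monoid)

lemma of_endomorphisms_to_endomorphisms:
  "s \<in> skew_monoidal_structures \<Longrightarrow> of_endomorphisms (to_endomorphisms s) = s"
  by (auto simp: skew_monoidal_structures_def to_endomorphisms_def of_endomorphisms_def
      skew_monoidal_monoid.star_eq_left_right)

text \<open>Restricting \<open>Q a * T b\<close> to one variable leaves a single factor because
  \<open>Q 1 = 1\<close> and \<open>T 1 = 1\<close>.\<close>

lemma to_endomorphisms_of_endomorphisms:
  "d \<in> skew_endomorphism_data_set \<Longrightarrow> to_endomorphisms (of_endomorphisms d) = d"
  by (auto simp: skew_endomorphism_data_set_def to_endomorphisms_def of_endomorphisms_def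
      skew_endomorphism_data.T_one skew_endomorphism_data.Q_one)

theorem lemma1p1:
  shows "bij_betw to_endomorphisms
           (skew_monoidal_structures :: (('a::monoid_mult \<Rightarrow> 'a \<Rightarrow> 'a) \<times> 'a \<times> 'a \<times> 'a) set)
           skew_endomorphism_data_set
       \<and> (\<forall>d \<in> (skew_endomorphism_data_set
                :: (('a \<Rightarrow> 'a) \<times> ('a \<Rightarrow> 'a) \<times> 'a \<times> 'a \<times> 'a) set).
            inv_into skew_monoidal_structures to_endomorphisms d = of_endomorphisms d)"
proof
  show bij: "bij_betw to_endomorphisms
      (skew_monoidal_structures :: (('a \<Rightarrow> 'a \<Rightarrow> 'a) \<times> 'a \<times> 'a \<times> 'a) set)
      skew_endomorphism_data_set"
    by (rule bij_betw_byWitness[where f' = of_endomorphisms])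
      (auto simp: to_endomorphisms_in of_endomorphisms_in
        of_endomorphisms_to_endomorphisms to_endomorphisms_of_endomorphisms)
  show "\<forall>d \<in> (skew_endomorphism_data_set
      :: (('a \<Rightarrow> 'a) \<times> ('a \<Rightarrow> 'a) \<times> 'a \<times> 'a \<times> 'a) set).
      inv_into skew_monoidal_structures to_endomorphisms d = of_endomorphisms d"
    \<comment> \<open>By injectivity, \<open>inv_into\<close> at d must be the structure
      \<open>of_endomorphisms d\<close>, which is known to map to d.\<close>
    using bij by (auto intro!: inv_into_f_eq
        simp: bij_betw_def of_endomorphisms_in to_endomorphisms_of_endomorphisms)
qed

end
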